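(* Let $m\ge1$ be an integer and $\boldsymbol\alpha=(\alpha_1,\ldots,\alpha_m)$ with all $\alpha_j>0$. There exists a finite constant $C_{m,\boldsymbol\alpha}$, depending only on $m$ and $\alpha_1,\ldots,\alpha_m$, such that the following holds. Let $(Z_t)_{t\in T}$ be an anchored $m$-regime mixed-tail process of orders $\boldsymbol\alpha$ with respect to $(d_1,\ldots,d_m)$, with anchor $t_0$, and let $\mu_1,\ldots,\mu_m$ be fixed probability measures on $(T,\mathcal A)$ (all as described in the context). Then for every $\delta\in(0,1)$ there is an event of probability at least $1-\delta$ on which, simultaneously for every $t\in T$, $$\|Z_t\|\le C_{m,\boldsymbol\alpha}\sum_{j=1}^m\Big[\Phi_j(t)+v_j(t)\Big(\log\frac{e}{\delta}\Big)^{1/\alpha_j}\Big].$$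
   Context: Setting. $(\mathbb B,\|\cdot\|)$ is a separable Banach space and $(T,\mathcal A)$ is a standard Borel space. For each $j\in\{1,\ldots,m\}$, $d_j:T\times T\to[0,\infty)$ is a finite-valued, jointly $\mathcal A\otimes\mathcal A$-measurable pseudo-metric; $\rho(s,t):=\sum_{j=1}^m d_j(s,t)$, and $(T,\rho)$ is assumed separable. All random objects are defined on a fixed probability space $(\Omega,\mathcal H,\mathbb P)$. $Z:\Omega\times T\to\mathbb B$ is jointly measurable from $(\Omega\times T,\mathcal H\otimes\mathcal A)$ to $(\mathbb B,\mathcal B(\mathbb B))$, and $Z_t(\omega):=Z(\omega,t)$. Anchored, with continuous paths: there exist $t_0\in T$ (the anchor) and an event $\Omega_0\in\mathcal H$ with $\mathbb P(\Omega_0)=1$ such that for every $\omega\in\Omega_0$, $Z_{t_0}(\omega)=0$ and $t\mapsto Z_t(\omega)$ is continuous from $(T,\rho)$ to $(\mathbb B,\|\cdot\|)$. $m$-regime mixed-tail process of orders $\boldsymbol\alpha$ with respect to $(d_1,\ldots,d_m)$: for every $s,t\in T$ and every $u\ge0$, $$\mathbb P\Big\{\|Z_t-Z_s\|>\sum_{j=1}^m u^{1/\alpha_j}d_j(t,s)\Big\}\le 2e^{-u}.$$ For $j\in\{1,\ldots,m\}$: $v_j(t):=d_j(t,t_0)$, $B_{d_j}(t,r):=\{s\in T:d_j(s,t)\le r\}$, and $$\Phi_j(t):=\int_0^{4v_j(t)}\Big(\log\frac{1}{\mu_j(B_{d_j}(t,r))}\Big)^{1/\alpha_j}dr\in[0,\infty],$$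 with the convention $\log(1/0):=+\infty$. *)

theory Defs
  imports "HOL-Probability.Probability"
begin

definition standard_borel :: "'a measure \<Rightarrow> bool" where
  "standard_borel M \<longleftrightarrow>
     (\<exists>X. completely_metrizable_space X \<and> separable_space X \<and> topspace X = space M \<and>
          sets M = sigma_sets (topspace X) {U. openin X U})"

definition pseudo_metric_on :: "'a set \<Rightarrow> ('a \<Rightarrow> 'a \<Rightarrow> real) \<Rightarrow> bool" where
  "pseudo_metric_on A d \<longleftrightarrow>
     (\<forall>x\<in>A. \<forall>y\<in>A. 0 \<le> d x y) \<and> (\<forall>x\<in>A. d x x = 0) \<and>
     (\<forall>x\<in>A. \<forall>y\<in>A. d x y = d y x) \<and>
     (\<forall>x\<in>A. \<forall>y\<in>A. \<forall>z\<in>A. d x z \<le> d x y + d y z)"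

definition separable_on :: "'a set \<Rightarrow> ('a \<Rightarrow> 'a \<Rightarrow> real) \<Rightarrow> bool" where
  "separable_on A \<rho> \<longleftrightarrow>
     (\<exists>D. countable D \<and> D \<subseteq> A \<and> (\<forall>x\<in>A. \<forall>e>0. \<exists>y\<in>D. \<rho> x y < e))"

definition continuous_wrt ::
  "'a set \<Rightarrow> ('a \<Rightarrow> 'a \<Rightarrow> real) \<Rightarrow> ('a \<Rightarrow> 'b::real_normed_vector) \<Rightarrow> bool" where
  "continuous_wrt A \<rho> f \<longleftrightarrow>
     (\<forall>x\<in>A. \<forall>e>0. \<exists>\<eta>>0. \<forall>y\<in>A. \<rho> x y < \<eta> \<longrightarrow> norm (f y - f x) < e)"

definition sum_metric :: "nat \<Rightarrow> (nat \<Rightarrow> 'a \<Rightarrow> 'a \<Rightarrow> real) \<Rightarrow> 'a \<Rightarrow> 'a \<Rightarrow> real" where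
  "sum_metric m d s t = (\<Sum>j=1..m. d j s t)"

definition index_space :: "nat \<Rightarrow> 'a measure \<Rightarrow> (nat \<Rightarrow> 'a \<Rightarrow> 'a \<Rightarrow> real) \<Rightarrow> bool" where
  "index_space m T d \<longleftrightarrow>
     standard_borel T \<and>
     (\<forall>j\<in>{1..m}. pseudo_metric_on (space T) (d j) \<and>
        (\<lambda>(s, t). d j s t) \<in> borel_measurable (T \<Otimes>\<^sub>M T)) \<and>
     separable_on (space T) (sum_metric m d)"

definition anchored_continuous ::
  "'w measure \<Rightarrow> 'a measure \<Rightarrow> ('a \<Rightarrow> 'a \<Rightarrow> real) \<Rightarrow> 'a \<Rightarrow>
   ('w \<Rightarrow> 'a \<Rightarrow> 'b::real_normed_vector) \<Rightarrow> bool" where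
  "anchored_continuous P T \<rho> t0 Z \<longleftrightarrow>
     t0 \<in> space T \<and>
     (\<exists>W\<in>sets P. measure P W = 1 \<and>
        (\<forall>\<omega>\<in>W. Z \<omega> t0 = 0 \<and> continuous_wrt (space T) \<rho> (Z \<omega>)))"

definition mixed_tail ::
  "nat \<Rightarrow> (nat \<Rightarrow> real) \<Rightarrow> 'w measure \<Rightarrow> 'a measure \<Rightarrow> (nat \<Rightarrow> 'a \<Rightarrow> 'a \<Rightarrow> real) \<Rightarrow>
   ('w \<Rightarrow> 'a \<Rightarrow> 'b::real_normed_vector) \<Rightarrow> bool" where
  "mixed_tail m \<alpha> P T d Z \<longleftrightarrow>
     (\<forall>s\<in>space T. \<forall>t\<in>space T. \<forall>u\<ge>0.
        measure P {\<omega> \<in> space P. norm (Z \<omega> t - Z \<omega> s) > (\<Sum>j=1..m. u powr (1 / \<alpha> j) * d j t s)}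
          \<le> 2 * exp (- u))"

(* (log (1/p)) to the power a for p in [0,1], with log (1/0) = infinity; note ln (1/0) = 0 in HOL *)
definition log_inv_powr :: "real \<Rightarrow> real \<Rightarrow> ennreal" where
  "log_inv_powr p a = (if p = 0 then \<infinity> else ennreal (ln (1 / p) powr a))"

definition closed_ball :: "'a measure \<Rightarrow> ('a \<Rightarrow> 'a \<Rightarrow> real) \<Rightarrow> 'a \<Rightarrow> real \<Rightarrow> 'a set" where
  "closed_ball T d t r = {s \<in> space T. d s t \<le> r}"

definition Phi ::
  "'a measure \<Rightarrow> ('a \<Rightarrow> 'a \<Rightarrow> real) \<Rightarrow> 'a measure \<Rightarrow> real \<Rightarrow> 'a \<Rightarrow> 'a \<Rightarrow> ennreal" where
  "Phi T d \<mu> a t0 t =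
     (\<integral>\<^sup>+r\<in>{0..4 * d t t0}. log_inv_powr (measure \<mu> (closed_ball T d t r)) (1 / a) \<partial>lborel)"

(* An existential inside a HOL statement cannot precede the type variables of the probability
   space, the index space and the Banach space, so on its own it would let the constant vary with
   those types.  Requiring it to be at most this crude closed-form expression in m and alpha makes
   the constant depend on m and alpha alone.  The form is that of a chaining argument whose
   increments at level n have tail parameter of order m 2^n, and in which the sums over levels of
   2^(n / alpha j) times a decreasing radius are summed by parts. *)
definition const_bound :: "nat \<Rightarrow> (nat \<Rightarrow> real) \<Rightarrow> real" where
  "const_bound m \<alpha> =
     100 * (\<Sum>j=1..m. (100 * real m) powr (1 / \<alpha> j)) * (\<Sum>j=1..m. 1 / (1 - 2 powr (- 1 / \<alpha> j)))"

end

theory Submission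
  imports Defs
begin

text \<open>
  Generic chaining, run directly on the measures. At level n let \<open>R_j(t)\<close> be the smaller of \<open>v_j(t)\<close> and
  the least radius at which the ball around t has \<open>\<mu>_j\<close>-mass at least \<open>(1/2)^(2^n)\<close>. A greedy disjoint
  family of such balls, together with the anchor, gives at most \<open>2^(2^n) + 1\<close> centres, one of them
  within \<open>2 R_j(t)\<close> of each t. Points with the same centres for all j form a cell, and every cell is
  represented by its point of least weighted total radius, the weights being the powers of the tail
  parameter that the tail bound attaches to the \<open>d_j\<close>. The chain starts at the anchor, at the first
  level with \<open>2^n \<ge> log (e/\<delta>)\<close>, so that the union bound over all levels costs at most \<open>\<delta>\<close> and the
  first link is paid for by the terms \<open>v_j(t) log (e/\<delta>)^(1/\<alpha>_j)\<close>; the other links sum to the integrals.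
  This is done on finite sets of points with finite integrals, where all minima exist; it extends to T
  along a countable set dense for \<open>\<rho>\<close> and for the value of the right-hand side simultaneously,
  because that right-hand side need not be continuous.
\<close>

section \<open>Disjoint subfamilies and common representatives\<close>

text \<open>Greedy selection: an index of least radius is kept, every index whose set meets its set
  is dropped, and the rest is treated by induction. A dropped index thus meets a kept one of no
  larger radius. Nonempty sets make the kept index leave the remainder, so the induction
  descends.\<close>

lemma finite_disjoint_subfamily:
  fixes r :: "'i \<Rightarrow> 'b::linorder" and B :: "'i \<Rightarrow> 'a set"
  assumes "finite S" and "\<And>s. s \<in> S \<Longrightarrow> B s \<noteq> {}"
  shows "\<exists>N\<subseteq>S. disjoint_family_on B N \<and> (\<forall>t\<in>S. \<exists>s\<in>N. r s \<le> r t \<and> B s \<inter> B t \<noteq> {})"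
  using assms
proof (induction "card S" arbitrary: S rule: less_induct)
  case less
  show ?case
  proof (cases "S = {}")
    case True
    then show ?thesis by (auto simp: disjoint_family_on_def)
  next
    case False
    obtain s where s: "s \<in> S" "\<And>t. t \<in> S \<Longrightarrow> r s \<le> r t"
      using arg_min_if_finite[OF less.prems(1) False, of r] by (metis not_le)
    define S' where "S' = {t \<in> S. B s \<inter> B t = {}}"
    have "S' \<subset> S" using s less.prems(2)[OF s(1)] by (auto simp: S'_def)
    then have "card S' < card S" using less.prems(1) psubset_card_mono by blast
    moreover have "finite S'" using less.prems(1) by (auto simp: S'_def)
    ultimately obtain N where N: "N \<subseteq> S'" "disjoint_family_on B N"
      "\<forall>t\<in>S'. \<exists>s\<in>N. r s \<le> r t \<and> B s \<inter> B t \<noteq> {}"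
      using less.hyps[of S'] less.prems(2) by (auto simp: S'_def)
    have "disjoint_family_on B (insert s N)"
      using N(1,2) unfolding disjoint_family_on_def S'_def by fastforce
    moreover have "\<forall>t\<in>S. \<exists>x\<in>insert s N. r x \<le> r t \<and> B x \<inter> B t \<noteq> {}"
      using N(3) s(2) unfolding S'_def by blast
    moreover have "insert s N \<subseteq> S" using N(1) s(1) by (auto simp: S'_def)
    ultimately show ?thesis by blast
  qed
qed

lemma (in prob_space) card_disjoint_family_le:
  assumes "finite N" "disjoint_family_on B N" "\<And>s. s \<in> N \<Longrightarrow> B s \<in> events" "\<And>s. s \<in> N \<Longrightarrow> a \<le> prob (B s)"
  shows "real (card N) * a \<le> 1"
proof -
  have "real (card N) * a \<le> (\<Sum>s\<in>N. prob (B s))"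
    using sum_bounded_below[of N a "\<lambda>s. prob (B s)"] assms(4) by simp
  also have "\<dots> = prob (\<Union>s\<in>N. B s)"
    using assms by (intro finite_measure_finite_Union[symmetric]) auto
  also have "\<dots> \<le> 1" by simp
  finally show ?thesis .
qed

text \<open>Centres are within twice the radius in each pseudo-metric, but a common representative of
  a cell cannot minimise all radii at once; minimising their weighted sum is enough.\<close>

lemma common_representatives:
  fixes d :: "'j \<Rightarrow> 't \<Rightarrow> 't \<Rightarrow> real"
  assumes "finite S" "finite J" "S \<subseteq> A"
    and pm: "\<And>j. j \<in> J \<Longrightarrow> pseudo_metric_on A (d j)"
    and c: "\<And>j t. j \<in> J \<Longrightarrow> t \<in> S \<Longrightarrow> c j t \<in> A \<and> d j t (c j t) \<le> 2 * R j t"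
    and K: "\<And>j. j \<in> J \<Longrightarrow> card (c j ` S) \<le> K"
    and w: "\<And>j. j \<in> J \<Longrightarrow> (w j :: real) \<ge> 0"
  shows "\<exists>\<pi>. \<pi> ` S \<subseteq> S \<and> card (\<pi> ` S) \<le> K ^ card J \<and>
    (\<forall>t\<in>S. (\<Sum>j\<in>J. w j * d j t (\<pi> t)) \<le> 4 * (\<Sum>j\<in>J. w j * R j t))"
proof -
  define F where "F t = (\<Sum>j\<in>J. w j * R j t)" for t
  define L where "L t = restrict (\<lambda>j. c j t) J" for t
  \<comment> \<open>The choice depends on the label alone, so there are at most as many
    representatives as labels.\<close>
  define h where "h l = arg_min_on F {s \<in> S. L s = l}" for l
  have h: "h (L t) \<in> S" "L (h (L t)) = L t" "F (h (L t)) \<le> F t" if "t \<in> S" for t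
  proof -
    have "finite {s \<in> S. L s = L t}" "{s \<in> S. L s = L t} \<noteq> {}" using assms(1) that by auto
    from arg_min_if_finite[OF this, of F] that
    show "h (L t) \<in> S" "L (h (L t)) = L t" "F (h (L t)) \<le> F t"
      unfolding h_def by (auto simp: not_less)
  qed
  have "card ((h \<circ> L) ` S) \<le> card (L ` S)"
    unfolding image_comp[symmetric] using assms(1) by (intro card_image_le) auto
  also have "\<dots> \<le> card (PiE J (\<lambda>j. c j ` S))"
    using assms(1,2) by (intro card_mono finite_PiE) (auto simp: L_def)
  also have "\<dots> = (\<Prod>j\<in>J. card (c j ` S))" using assms(2) by (simp add: card_PiE)
  also have "\<dots> \<le> K ^ card J" using prod_mono[of J "\<lambda>j. card (c j ` S)" "\<lambda>_. K"] K by simp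
  finally have "card ((h \<circ> L) ` S) \<le> K ^ card J" .
  moreover have "(\<Sum>j\<in>J. w j * d j t ((h \<circ> L) t)) \<le> 4 * F t" if t: "t \<in> S" for t
  proof -
    let ?q = "h (L t)"
    have "(\<Sum>j\<in>J. w j * d j t ?q) \<le> (\<Sum>j\<in>J. w j * (2 * R j t + 2 * R j ?q))"
    proof (intro sum_mono mult_left_mono)
      fix j assume j: "j \<in> J"
      \<comment> \<open>Equal labels mean equal centres, so the path through the common centre costs
        \<open>2 * R j t + 2 * R j ?q\<close>. The weighted sum is
        \<open>2 * F t + 2 * F ?q\<close>, and minimality of \<open>F ?q\<close> turns this into
        \<open>4 * F t\<close>.\<close>
      have eq: "c j ?q = c j t" using h(2)[OF t] j by (metis L_def restrict_apply')
      have A: "t \<in> A" "?q \<in> A" "c j t \<in> A" using c[OF j t] h(1)[OF t] t assms(3) by auto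
      have "d j t ?q \<le> d j t (c j t) + d j ?q (c j t)"
        using pm[OF j] A unfolding pseudo_metric_on_def by metis
      then show "d j t ?q \<le> 2 * R j t + 2 * R j ?q"
        using c[OF j t] c[OF j h(1)[OF t]] eq by auto
    qed (use w in auto)
    also have "\<dots> = 2 * F t + 2 * F ?q"
      by (simp add: F_def sum.distrib sum_distrib_left algebra_simps)
    finally show ?thesis using h(3)[OF t] by simp
  qed
  ultimately show ?thesis using h(1) unfolding F_def
    by (intro exI[of _ "h \<circ> L"]) auto
qed

section \<open>Radii at which balls reach a given mass\<close>

lemma one_minus_two_powr_pos: "0 < a \<Longrightarrow> 0 < 1 - (2::real) powr (- 1 / a)"
  using powr_less_mono[of "- 1 / a" 0 2] by simp

text \<open>Inserting \<open>d t t0\<close> keeps the set nonempty, caps the radius so that it stays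
  inside the integration range of \<open>Phi\<close>, and singles out the points that take the
  anchor as centre.\<close>

definition mass_radius ::
  "'t measure \<Rightarrow> ('t \<Rightarrow> 't \<Rightarrow> real) \<Rightarrow> 't measure \<Rightarrow> 't \<Rightarrow> real \<Rightarrow> 't \<Rightarrow> real" where
  "mass_radius T d \<mu> t0 a t = Inf (insert (d t t0) {r. 0 \<le> r \<and> a \<le> measure \<mu> (closed_ball T d t r)})"

locale majorizing_measure = prob_space \<mu> for \<mu> :: "'t measure" +
  fixes T :: "'t measure" and d :: "'t \<Rightarrow> 't \<Rightarrow> real" and t0 :: 't
  assumes pm: "pseudo_metric_on (space T) d"
    and dm: "(\<lambda>(s, t). d s t) \<in> borel_measurable (T \<Otimes>\<^sub>M T)"
    and sets_eq: "sets \<mu> = sets T"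
    and t0: "t0 \<in> space T"
begin

lemma ball_event: "t \<in> space T \<Longrightarrow> closed_ball T d t r \<in> events"
proof -
  assume t: "t \<in> space T"
  have "(\<lambda>s. (\<lambda>(s, t). d s t) (s, t)) \<in> borel_measurable T"
    by (rule measurable_compose[OF measurable_Pair2'[OF t] dm])
  then have "(\<lambda>s. d s t) \<in> borel_measurable T" by simp
  then show ?thesis unfolding closed_ball_def sets_eq by measurable
qed

lemma dist_nonneg: "s \<in> space T \<Longrightarrow> t \<in> space T \<Longrightarrow> 0 \<le> d s t"
  using pm by (auto simp: pseudo_metric_on_def)

lemma mass_radius_bdd: "t \<in> space T \<Longrightarrow>
  bdd_below (insert (d t t0) {r. 0 \<le> r \<and> a \<le> prob (closed_ball T d t r)})"
  by (rule bdd_belowI[of _ 0]) (auto intro: dist_nonneg t0)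

lemma mass_radius_le: "t \<in> space T \<Longrightarrow> mass_radius T d \<mu> t0 a t \<le> d t t0"
  unfolding mass_radius_def by (rule cInf_lower[OF _ mass_radius_bdd]) auto

lemma mass_radius_nonneg: "t \<in> space T \<Longrightarrow> 0 \<le> mass_radius T d \<mu> t0 a t"
  unfolding mass_radius_def by (rule cInf_greatest) (auto intro: dist_nonneg t0)

lemma prob_ball_less:
  assumes "t \<in> space T" "0 \<le> r" "r < mass_radius T d \<mu> t0 a t"
  shows "prob (closed_ball T d t r) < a"
proof (rule ccontr)
  assume "\<not> ?thesis"
  then have "mass_radius T d \<mu> t0 a t \<le> r"
    unfolding mass_radius_def using assms by (intro cInf_lower mass_radius_bdd) auto
  then show False using assms by simp
qed

text \<open>Below the cap the infimum is attained: the balls of radius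
  \<open>?R + 1 / real (Suc k)\<close> have mass at least \<open>a\<close> and decrease to the
  closed ball of radius \<open>?R\<close>, so continuity from above applies.\<close>

lemma prob_ball_mass_radius:
  assumes t: "t \<in> space T" and less: "mass_radius T d \<mu> t0 a t < d t t0"
  shows "a \<le> prob (closed_ball T d t (mass_radius T d \<mu> t0 a t))"
proof -
  let ?R = "mass_radius T d \<mu> t0 a t"
  let ?B = "\<lambda>k. closed_ball T d t (?R + 1 / real (Suc k))"
  have "a \<le> prob (?B k)" for k
  proof -
    \<comment> \<open>The minimum with \<open>d t t0\<close> keeps the inserted cap from being the
      witness, so the radius obtained really has mass at least \<open>a\<close>.\<close>
    have "?R < min (d t t0) (?R + 1 / real (Suc k))" using less by simp
    then obtain r where r: "r \<in> insert (d t t0) {r. 0 \<le> r \<and> a \<le> prob (closed_ball T d t r)}"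
      "r < min (d t t0) (?R + 1 / real (Suc k))"
      unfolding mass_radius_def using cInf_lessD[of "insert (d t t0) _"] by blast
    then have "a \<le> prob (closed_ball T d t r)" by auto
    also have "\<dots> \<le> prob (?B k)"
      using r by (intro finite_measure_mono ball_event t) (auto simp: closed_ball_def)
    finally show ?thesis .
  qed
  then have ge: "\<forall>k\<ge>0. a \<le> prob (?B k)" by blast
  have lim: "(\<lambda>k. prob (?B k)) \<longlonglongrightarrow> prob (\<Inter>k. ?B k)"
  proof (rule finite_Lim_measure_decseq)
    show "decseq ?B"
    proof (rule decseq_SucI)
      fix k
      have "1 / real (Suc (Suc k)) \<le> 1 / real (Suc k)" by (intro divide_left_mono) auto
      then show "?B (Suc k) \<subseteq> ?B k" unfolding closed_ball_def by force
    qed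
  qed (use ball_event t in auto)
  have "(\<Inter>k. ?B k) = closed_ball T d t ?R"
  proof -
    have "s \<in> closed_ball T d t ?R" if s: "s \<in> (\<Inter>k. ?B k)" for s
    proof -
      have "d s t \<le> ?R + 1 / real (Suc k)" for k using s by (auto simp: closed_ball_def)
      moreover have "(\<lambda>k. ?R + 1 / real (Suc k)) \<longlonglongrightarrow> ?R + 0"
        by (intro tendsto_add tendsto_const LIMSEQ_Suc lim_1_over_n)
      ultimately have "d s t \<le> ?R" using LIMSEQ_le_const[of _ "?R + 0" "d s t"] by auto
      then show ?thesis using s by (auto simp: closed_ball_def)
    qed
    moreover have "closed_ball T d t ?R \<subseteq> (\<Inter>k. ?B k)"
      by (force simp: closed_ball_def simp del: of_nat_Suc intro: add_increasing2)
    ultimately show ?thesis by blast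
  qed
  then show ?thesis using Lim_bounded2[OF lim, of 0 a] ge by simp
qed

text \<open>At most \<open>1 / a\<close> disjoint balls can have mass \<open>a\<close> or more. A
  ball that meets a chosen one of no larger radius has its centre within twice its own radius of the
  chosen centre. Points at the cap use the anchor, at distance exactly their radius; this is the
  \<open>+ 1\<close>.\<close>

lemma centres:
  assumes "finite S" "S \<subseteq> space T" "0 < a"
  shows "\<exists>c. (\<forall>t\<in>S. c t \<in> space T \<and> d t (c t) \<le> 2 * mass_radius T d \<mu> t0 a t) \<and>
    real (card (c ` S)) \<le> 1 / a + 1"
proof -
  let ?R = "mass_radius T d \<mu> t0 a"
  define S' where "S' = {t \<in> S. ?R t < d t t0}"
  define B where "B t = closed_ball T d t (?R t)" for t
  have fin: "finite S'" using assms by (auto simp: S'_def)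
  have sub: "t \<in> space T" if "t \<in> S'" for t using that assms by (auto simp: S'_def)
  have "B t \<noteq> {}" if "t \<in> S'" for t
  proof -
    have "d t t = 0" using sub[OF that] pm by (simp add: pseudo_metric_on_def)
    then have "t \<in> B t"
      using mass_radius_nonneg[OF sub[OF that]] sub[OF that] by (simp add: B_def closed_ball_def)
    then show ?thesis by blast
  qed
  then obtain N where N: "N \<subseteq> S'" "disjoint_family_on B N"
    "\<And>t. t \<in> S' \<Longrightarrow> \<exists>s\<in>N. ?R s \<le> ?R t \<and> B s \<inter> B t \<noteq> {}"
    using finite_disjoint_subfamily[OF fin, of B ?R] by blast
  then obtain f where f: "\<And>t. t \<in> S' \<Longrightarrow> f t \<in> N \<and> ?R (f t) \<le> ?R t \<and> B (f t) \<inter> B t \<noteq> {}"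
    by metis
  define c where "c t = (if t \<in> S' then f t else t0)" for t
  have finN: "finite N" using N fin finite_subset by blast
  have "real (card N) * a \<le> 1"
  proof (rule card_disjoint_family_le[OF finN N(2)])
    fix s assume "s \<in> N"
    then have "s \<in> S'" using N by auto
    then show "B s \<in> events" "a \<le> prob (B s)"
      unfolding B_def using prob_ball_mass_radius sub by (auto intro: ball_event simp: S'_def)
  qed
  then have "real (card N) \<le> 1 / a" using assms(3) by (simp add: field_simps)
  moreover have "card (c ` S) \<le> card (insert t0 N)"
    using f finN by (intro card_mono) (auto simp: c_def)
  moreover have "card (insert t0 N) \<le> card N + 1" using finN by (simp add: card_insert_if)
  ultimately have "real (card (c ` S)) \<le> 1 / a + 1" by linarith
  moreover have "c t \<in> space T \<and> d t (c t) \<le> 2 * ?R t" if t: "t \<in> S" for t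
  proof (cases "t \<in> S'")
    case True
    then have ft: "f t \<in> space T" "t \<in> space T" using f N(1) sub by blast+
    obtain x where "x \<in> B (f t)" "x \<in> B t" using f[OF True] by blast
    then have x: "x \<in> space T" "d x (f t) \<le> ?R (f t)" "d x t \<le> ?R t"
      by (auto simp: B_def closed_ball_def)
    have "d t (f t) \<le> d x t + d x (f t)" using pm ft x(1) unfolding pseudo_metric_on_def by metis
    then show ?thesis using True ft x f[OF True] by (auto simp: c_def)
  next
    case False
    then have "?R t = d t t0"
      using t mass_radius_le[of t a] assms by (fastforce simp: S'_def)
    moreover have "0 \<le> d t t0" using t assms t0 by (auto intro: dist_nonneg)
    ultimately show ?thesis using False t0 by (auto simp: c_def)
  qed
  ultimately show ?thesis by blast
qed

text \<open>The radii at which the ball around t has mass below \<open>(1/2)^(2^n)\<close> make up an interval; summing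
  the geometric weights under the integral sign replaces a summation by parts over the levels.\<close>

lemma sum_mass_radius_le_Phi:
  assumes t: "t \<in> space T" and a: "0 < a"
  defines "R n \<equiv> mass_radius T d \<mu> t0 ((1/2) ^ (2 ^ n)) t"
  shows "ennreal (\<Sum>n<N. (1/2) powr (1/a) * (1 - 2 powr (- 1 / a)) * (2 ^ n) powr (1/a) * R n)
    \<le> Phi T d \<mu> a t0 t"
proof -
  define p where "p = 1 / a"
  \<comment> \<open>The factor \<open>1 - 2 powr (- p)\<close> normalises the geometric sum in
    \<open>geo\<close>; \<open>(1/2) powr p\<close> pays for replacing \<open>ln 2\<close> by
    \<open>1/2\<close> in the logarithm of the mass bound.\<close>
  define \<kappa> where "\<kappa> = (1/2) powr p * (1 - 2 powr (- p))"
  define k where "k n = \<kappa> * (2 ^ n) powr p" for n :: nat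
  have p: "p > 0" using a by (simp add: p_def)
  have "\<kappa> \<ge> 0" using one_minus_two_powr_pos[OF a] by (simp add: \<kappa>_def p_def)
  then have k0: "k n \<ge> 0" for n by (simp add: k_def)
  have R0: "0 \<le> R n" "R n \<le> d t t0" for n
    using mass_radius_nonneg[OF t] mass_radius_le[OF t] by (auto simp: R_def)
  have geo: "(1 - 2 powr (- p)) * (\<Sum>n\<le>M. (2 ^ n) powr p) \<le> (2 ^ M) powr p" for M :: nat
  proof (induction M)
    case (Suc M)
    \<comment> \<open>Multiplied by \<open>1 - 2 powr (- p)\<close>, the new term becomes its
      difference from the preceding one, so the sum telescopes.\<close>
    have "2 powr (- p) * ((2 ^ Suc M) powr p) = (2 ^ M) powr p"
      by (simp add: powr_mult powr_minus field_simps)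
    with Suc show ?case by (simp add: algebra_simps del: power_Suc)
  qed simp
  have pointwise: "(\<Sum>n<N. ennreal (k n) * indicator {0..<R n} r)
      \<le> log_inv_powr (prob (closed_ball T d t r)) p * indicator {0..4 * d t t0} r" for r
  proof (cases "\<exists>n<N. r \<in> {0..<R n}")
    case False
    then have "(\<Sum>n<N. ennreal (k n) * indicator {0..<R n} r) = 0"
      by (intro sum.neutral) auto
    then show ?thesis by simp
  next
    case True
    define A where "A = {n. n < N \<and> r \<in> {0..<R n}}"
    \<comment> \<open>The last level whose radius exceeds \<open>r\<close> gives the strongest mass
      bound. All levels in \<open>A\<close> are at most \<open>M\<close>, so a single logarithm
      dominates the whole sum.\<close>
    define M where "M = Max A"
    define q where "q = prob (closed_ball T d t r)"
    have A: "finite A" "A \<noteq> {}" using True by (auto simp: A_def)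
    have M: "M \<in> A" "\<And>n. n \<in> A \<Longrightarrow> n \<le> M" using A by (auto simp: M_def)
    have r: "0 \<le> r" "r < R M" using M(1) by (auto simp: A_def)
    have q: "q < (1/2) ^ (2 ^ M)"
      unfolding q_def using prob_ball_less[OF t r(1)] r(2) by (auto simp: R_def)
    have "(\<Sum>n<N. ennreal (k n) * indicator {0..<R n} r) = (\<Sum>n\<in>A. ennreal (k n))"
      unfolding A_def by (intro sum.mono_neutral_cong_right) (auto simp: indicator_def)
    also have "\<dots> \<le> (\<Sum>n\<le>M. ennreal (k n))" using M(2) by (intro sum_mono2) auto
    also have "\<dots> = ennreal (\<Sum>n\<le>M. k n)" using k0 by (intro sum_ennreal) auto
    also have "\<dots> \<le> log_inv_powr q p"
    proof (cases "q = 0")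
      case False
      then have qpos: "q > 0" using measure_nonneg unfolding q_def by (simp add: less_le)
      have "(\<Sum>n\<le>M. k n) = (1/2) powr p * ((1 - 2 powr (- p)) * (\<Sum>n\<le>M. (2 ^ n) powr p))"
        by (simp add: k_def \<kappa>_def sum_distrib_left mult.assoc)
      also have "\<dots> \<le> (1/2) powr p * (2 ^ M) powr p" by (intro mult_left_mono geo) auto
      also have "\<dots> = (2 ^ M / 2) powr p" by (subst powr_mult[symmetric]) auto
      also have "\<dots> \<le> ln (1 / q) powr p"
      proof (rule powr_mono2)
        have "2 ^ M / 2 \<le> real (2 ^ M) * ln 2" using ln2_ge_two_thirds by (simp add: field_simps)
        also have "\<dots> = ln (2 ^ (2 ^ M))" by (subst ln_realpow) auto
        also have "\<dots> \<le> ln (1 / q)"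
          using q qpos by (subst ln_le_cancel_iff) (auto simp: field_simps power_one_over)
        finally show "2 ^ M / 2 \<le> ln (1 / q)" .
      qed (use p in auto)
      finally show ?thesis using False by (simp add: log_inv_powr_def ennreal_leI)
    qed (simp add: log_inv_powr_def)
    \<comment> \<open>As \<open>r < R M\<close> and \<open>R M\<close> is capped by
      \<open>d t t0\<close>, the point \<open>r\<close> lies in the integration range.\<close>
    finally show ?thesis using r R0[of M] by (simp add: q_def indicator_def)
  qed
  have "ennreal (\<Sum>n<N. k n * R n) = (\<Sum>n<N. ennreal (k n) * emeasure lborel {0..<R n})"
    using k0 R0 by (subst sum_ennreal[symmetric]) (auto simp: ennreal_mult)
  also have "\<dots> = (\<integral>\<^sup>+r. (\<Sum>n<N. ennreal (k n) * indicator {0..<R n} r) \<partial>lborel)"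
    by (subst nn_integral_sum) (auto simp: nn_integral_cmult_indicator)
  also have "\<dots> \<le> Phi T d \<mu> a t0 t"
    unfolding Phi_def using pointwise by (intro nn_integral_mono) (simp add: p_def)
  finally show ?thesis by (simp add: k_def \<kappa>_def p_def)
qed

end

section \<open>Separability of graphs of arbitrary functions\<close>

text \<open>The graph of \<open>g\<close> over \<open>S\<close> sits inside the separable product of
  \<open>A\<close> with the reals, so it is separable even for discontinuous \<open>g\<close>. One
  point of \<open>S\<close> is picked for each inhabited neighbourhood given by a point of
  \<open>D0\<close>, a rational value and a scale.\<close>

lemma separable_on_graph:
  fixes \<rho> :: "'a \<Rightarrow> 'a \<Rightarrow> real" and g :: "'a \<Rightarrow> real"
  assumes sep: "separable_on A \<rho>" and pm: "pseudo_metric_on A \<rho>" and S: "S \<subseteq> A"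
  shows "\<exists>D\<subseteq>S. countable D \<and> (\<forall>t\<in>S. \<forall>e>0. \<exists>s\<in>D. \<rho> t s < e \<and> \<bar>g t - g s\<bar> < e)"
proof -
  obtain D0 where D0: "countable D0" "D0 \<subseteq> A" "\<And>x e. x \<in> A \<Longrightarrow> 0 < e \<Longrightarrow> \<exists>y\<in>D0. \<rho> x y < e"
    using sep unfolding separable_on_def by blast
  define near where "near = (\<lambda>(x, q :: rat, k :: nat) s. s \<in> S \<and> \<rho> s x < 1 / Suc k \<and> \<bar>g s - of_rat q\<bar> < 1 / Suc k)"
  define I where "I = {i \<in> D0 \<times> UNIV \<times> UNIV. \<exists>s. near i s}"
  define f where "f i = (SOME s. near i s)" for i
  have f: "near i (f i)" if "i \<in> I" for i
    using that unfolding f_def I_def by (auto intro: someI)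
  have "countable I"
    unfolding I_def using D0(1) by (intro countable_subset[OF Collect_restrict] countable_SIGMA) auto
  then have "countable (f ` I)" by simp
  moreover have "f ` I \<subseteq> S" using f by (auto simp: near_def)
  moreover have "\<exists>s\<in>f ` I. \<rho> t s < e \<and> \<bar>g t - g s\<bar> < e" if t: "t \<in> S" and e: "0 < e" for t e
  proof -
    obtain k where k: "1 / Suc k < e / 2"
      using nat_approx_posE[of "e / 2"] e by auto
    obtain x where x: "x \<in> D0" "\<rho> t x < 1 / Suc k"
      using D0(3)[of t "1 / Suc k"] t S by auto
    obtain q :: rat where "g t < of_rat q" "of_rat q < g t + 1 / Suc k"
      using of_rat_dense[of "g t" "g t + 1 / Suc k"] by auto
    then have q: "\<bar>g t - of_rat q\<bar> < 1 / Suc k" by simp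
    let ?s = "f (x, q, k)"
    have I: "(x, q, k) \<in> I" using x q t by (auto simp: I_def near_def)
    have s: "?s \<in> S" "\<rho> ?s x < 1 / Suc k" "\<bar>g ?s - of_rat q\<bar> < 1 / Suc k"
      using f[OF I] by (auto simp: near_def)
    have A: "t \<in> A" "?s \<in> A" "x \<in> A" using t s S x D0 by auto
    have "\<rho> t ?s \<le> \<rho> t x + \<rho> ?s x" using pm A unfolding pseudo_metric_on_def by metis
    then have "\<rho> t ?s < e" using x s k by linarith
    moreover have "\<bar>g t - g ?s\<bar> < e" using q s k by linarith
    ultimately show ?thesis using I by blast
  qed
  ultimately show ?thesis by (intro exI[of _ "f ` I"]) blast
qed

lemma const_bound_pos:
  assumes "m \<ge> 1" and "\<And>j. j \<in> {1..m} \<Longrightarrow> \<alpha> j > 0"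
  shows "const_bound m \<alpha> > 0"
proof -
  have "0 < 1 - 2 powr (- 1 / \<alpha> j)" if "j \<in> {1..m}" for j
    using one_minus_two_powr_pos assms(2)[OF that] by blast
  then show ?thesis
    unfolding const_bound_def using assms(1) by (intro mult_pos_pos sum_pos) auto
qed

section \<open>The process and the union bound over finitely many pairs\<close>

locale chaining = prob_space P for P :: "'w measure" +
  fixes m :: nat and \<alpha> :: "nat \<Rightarrow> real" and T :: "'t measure" and d :: "nat \<Rightarrow> 't \<Rightarrow> 't \<Rightarrow> real"
    and Z :: "'w \<Rightarrow> 't \<Rightarrow> 'b::{banach, second_countable_topology}" and t0 :: 't
    and \<mu> :: "nat \<Rightarrow> 't measure" and W :: "'w set"
  assumes m: "m \<ge> 1" and \<alpha>: "\<And>j. j \<in> {1..m} \<Longrightarrow> \<alpha> j > 0"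
    and mm: "\<And>j. j \<in> {1..m} \<Longrightarrow> majorizing_measure (\<mu> j) T (d j) t0"
    and t0: "t0 \<in> space T"
    and Z: "\<And>t. t \<in> space T \<Longrightarrow> (\<lambda>\<omega>. Z \<omega> t) \<in> borel_measurable P"
    and tail: "mixed_tail m \<alpha> P T d Z"
    and W: "W \<in> sets P" "prob W = 1"
    and path: "\<And>\<omega>. \<omega> \<in> W \<Longrightarrow> Z \<omega> t0 = 0 \<and> continuous_wrt (space T) (sum_metric m d) (Z \<omega>)"
begin

lemma pm: "j \<in> {1..m} \<Longrightarrow> pseudo_metric_on (space T) (d j)"
  using mm by (simp add: majorizing_measure_def majorizing_measure_axioms_def)

lemma d_nonneg: "j \<in> {1..m} \<Longrightarrow> s \<in> space T \<Longrightarrow> t \<in> space T \<Longrightarrow> 0 \<le> d j s t"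
  using pm[of j] by (auto simp: pseudo_metric_on_def)

lemma d_triangle: "j \<in> {1..m} \<Longrightarrow> s \<in> space T \<Longrightarrow> t \<in> space T \<Longrightarrow> x \<in> space T \<Longrightarrow>
    d j s t \<le> d j x s + d j x t"
  using pm[of j] unfolding pseudo_metric_on_def by metis

definition bad_increments :: "('t \<times> 't) set \<Rightarrow> real \<Rightarrow> 'w set" where
  "bad_increments Q u = (\<Union>(s, t)\<in>Q.
     {\<omega> \<in> space P. norm (Z \<omega> t - Z \<omega> s) > (\<Sum>j=1..m. u powr (1 / \<alpha> j) * d j t s)})"

lemma bad_increments:
  assumes "finite Q" "Q \<subseteq> space T \<times> space T" "0 \<le> u"
  shows "bad_increments Q u \<in> events" "prob (bad_increments Q u) \<le> real (card Q) * (2 * exp (- u))"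
proof -
  let ?B = "\<lambda>(s, t). {\<omega> \<in> space P. norm (Z \<omega> t - Z \<omega> s) > (\<Sum>j=1..m. u powr (1 / \<alpha> j) * d j t s)}"
  have ev: "?B x \<in> events" if "x \<in> Q" for x
  proof -
    obtain s t where x: "x = (s, t)" "s \<in> space T" "t \<in> space T" using \<open>x \<in> Q\<close> assms(2) by (cases x) auto
    note [measurable] = Z[OF x(2)] Z[OF x(3)]
    show ?thesis unfolding x(1) by simp
  qed
  have eq: "bad_increments Q u = (\<Union>x\<in>Q. ?B x)" by (auto simp: bad_increments_def)
  show "bad_increments Q u \<in> events" unfolding eq using assms(1) ev by (intro sets.finite_UN) auto
  have "prob (\<Union>x\<in>Q. ?B x) \<le> (\<Sum>x\<in>Q. prob (?B x))"
    using assms(1) ev by (intro finite_measure_subadditive_finite) auto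
  also have "\<dots> \<le> (\<Sum>x\<in>Q. 2 * exp (- u))"
    using tail assms(2,3) unfolding mixed_tail_def by (intro sum_mono) auto
  finally show "prob (bad_increments Q u) \<le> real (card Q) * (2 * exp (- u))" unfolding eq by simp
qed

section \<open>Levels: radii, weights, total cost and representatives\<close>

definition level_radius :: "nat \<Rightarrow> nat \<Rightarrow> 't \<Rightarrow> real" where
  "level_radius n j t = mass_radius T (d j) (\<mu> j) t0 ((1/2) ^ (2 ^ n)) t"

text \<open>This is the factor of \<open>d j\<close> in the tail bound at parameter
  \<open>12 * m * 2 ^ n\<close>, the parameter that \<open>finite_set_bound\<close> uses for the
  link from level n to level \<open>Suc n\<close>.\<close>

definition weight :: "nat \<Rightarrow> nat \<Rightarrow> real" where
  "weight n j = (12 * real m * 2 ^ n) powr (1 / \<alpha> j)"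

definition level_cost :: "nat \<Rightarrow> 't \<Rightarrow> real" where
  "level_cost n t = (\<Sum>j=1..m. weight n j * level_radius n j t)"

text \<open>It dominates the level costs summed over all levels, at points where the integrals are
  finite (\<open>enn2real\<close> sends infinity to 0). The 24 is the 12 of \<open>weight\<close>
  times 2, which undoes the factor \<open>(1/2) powr (1/a)\<close> in
  \<open>sum_mass_radius_le_Phi\<close>.\<close>

definition majorant :: "'t \<Rightarrow> real" where
  "majorant t = (\<Sum>j=1..m. (24 * real m) powr (1 / \<alpha> j) / (1 - 2 powr (- 1 / \<alpha> j))
     * enn2real (Phi T (d j) (\<mu> j) (\<alpha> j) t0 t))"

lemma weight_pos: "weight n j > 0"
  using m by (simp add: weight_def)

lemma level_radius_nonneg: "j \<in> {1..m} \<Longrightarrow> t \<in> space T \<Longrightarrow> 0 \<le> level_radius n j t"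
  unfolding level_radius_def by (rule majorizing_measure.mass_radius_nonneg[OF mm])

lemma level_cost_nonneg: "t \<in> space T \<Longrightarrow> 0 \<le> level_cost n t"
  unfolding level_cost_def
  by (intro sum_nonneg mult_nonneg_nonneg level_radius_nonneg less_imp_le[OF weight_pos]) auto

lemma sum_level_cost_le_majorant:
  assumes t: "t \<in> space T" and fin: "\<And>j. j \<in> {1..m} \<Longrightarrow> Phi T (d j) (\<mu> j) (\<alpha> j) t0 t < \<infinity>"
  shows "(\<Sum>n<N. level_cost n t) \<le> majorant t"
proof -
  have "(\<Sum>n<N. level_cost n t) = (\<Sum>j=1..m. \<Sum>n<N. weight n j * level_radius n j t)"
    unfolding level_cost_def by (rule sum.swap)
  also have "\<dots> \<le> majorant t"
    unfolding majorant_def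
  proof (intro sum_mono)
    fix j assume j: "j \<in> {1..m}"
    define p where "p = 1 / \<alpha> j"
    define \<kappa> where "\<kappa> = (1/2) powr p * (1 - 2 powr (- 1 / \<alpha> j))"
    have \<kappa>: "\<kappa> > 0" using one_minus_two_powr_pos[OF \<alpha>[OF j]] by (simp add: \<kappa>_def)
    have "ennreal (\<Sum>n<N. \<kappa> * (2 ^ n) powr p * level_radius n j t) \<le> Phi T (d j) (\<mu> j) (\<alpha> j) t0 t"
      using majorizing_measure.sum_mass_radius_le_Phi[OF mm[OF j] t \<alpha>[OF j], of N]
      by (simp add: \<kappa>_def p_def level_radius_def)
    then have le: "(\<Sum>n<N. \<kappa> * (2 ^ n) powr p * level_radius n j t)
        \<le> enn2real (Phi T (d j) (\<mu> j) (\<alpha> j) t0 t)"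
      using fin[OF j] by (subst ennreal_le_iff[symmetric]) (auto simp: ennreal_enn2real)
    have "(12 * real m) powr p / \<kappa> = (12 * real m) powr p * 2 powr p / (1 - 2 powr (- 1 / \<alpha> j))"
      by (simp add: \<kappa>_def powr_divide)
    also have "\<dots> = (24 * real m) powr p / (1 - 2 powr (- 1 / \<alpha> j))"
      by (subst powr_mult[symmetric]) auto
    finally have c: "(12 * real m) powr p / \<kappa> = (24 * real m) powr p / (1 - 2 powr (- 1 / \<alpha> j))" .
    have "(\<Sum>n<N. weight n j * level_radius n j t)
        = (\<Sum>n<N. (12 * real m) powr p / \<kappa> * (\<kappa> * (2 ^ n) powr p * level_radius n j t))"
      using \<kappa> by (intro sum.cong) (auto simp: weight_def p_def powr_mult)
    also have "\<dots> = (12 * real m) powr p / \<kappa> * (\<Sum>n<N. \<kappa> * (2 ^ n) powr p * level_radius n j t)"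
      by (simp add: sum_distrib_left)
    also have "\<dots> \<le> (12 * real m) powr p / \<kappa> * enn2real (Phi T (d j) (\<mu> j) (\<alpha> j) t0 t)"
      using \<kappa> by (intro mult_left_mono le) auto
    finally show "(\<Sum>n<N. weight n j * level_radius n j t)
        \<le> (24 * real m) powr (1 / \<alpha> j) / (1 - 2 powr (- 1 / \<alpha> j)) * enn2real (Phi T (d j) (\<mu> j) (\<alpha> j) t0 t)"
      unfolding c by (simp add: p_def)
  qed
  finally show ?thesis .
qed

text \<open>Each measure contributes at most \<open>2 ^ (2 ^ n) + 1\<close> centres. Rounding this
  up to \<open>4 ^ (2 ^ n)\<close> makes the product over the m measures a pure power of 2.\<close>

lemma level_map:
  assumes S: "finite S" "S \<subseteq> space T"
  shows "\<exists>\<pi>. \<pi> ` S \<subseteq> S \<and> card (\<pi> ` S) \<le> 2 ^ (2 * m * 2 ^ n) \<and>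
    (\<forall>t\<in>S. (\<Sum>j=1..m. weight n j * d j t (\<pi> t)) \<le> 4 * level_cost n t)"
proof -
  have "\<forall>j\<in>{1..m}. \<exists>c. (\<forall>t\<in>S. c t \<in> space T \<and> d j t (c t) \<le> 2 * level_radius n j t) \<and>
    real (card (c ` S)) \<le> 1 / (1/2) ^ (2 ^ n) + 1"
    unfolding level_radius_def using majorizing_measure.centres[OF mm S] by simp
  then obtain c where c: "\<And>j t. j \<in> {1..m} \<Longrightarrow> t \<in> S \<Longrightarrow> c j t \<in> space T \<and> d j t (c j t) \<le> 2 * level_radius n j t"
    "\<And>j. j \<in> {1..m} \<Longrightarrow> real (card (c j ` S)) \<le> 1 / (1/2) ^ (2 ^ n) + 1"
    by metis
  have card: "card (c j ` S) \<le> 4 ^ (2 ^ n)" if "j \<in> {1..m}" for j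
  proof -
    have "real (card (c j ` S)) \<le> 2 ^ (2 ^ n) + 1" using c(2)[OF that] by (simp add: power_one_over)
    also have "\<dots> \<le> 2 ^ (2 ^ n) * 2 ^ (2 ^ n)"
    proof -
      have "2 \<le> (2 :: real) ^ (2 ^ n)" using self_le_power[of "2::real" "2 ^ n"] by simp
      then show ?thesis
        using mult_right_mono[of 2 "(2 :: real) ^ (2 ^ n)" "2 ^ (2 ^ n)"] by linarith
    qed
    also have "\<dots> = (4 :: real) ^ (2 ^ n)" by (simp add: power_mult_distrib[symmetric])
    finally show ?thesis by (metis of_nat_le_iff of_nat_numeral of_nat_power)
  qed
  obtain \<pi> where \<pi>: "\<pi> ` S \<subseteq> S" "card (\<pi> ` S) \<le> (4 ^ (2 ^ n)) ^ card {1..m}"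
    "\<forall>t\<in>S. (\<Sum>j=1..m. weight n j * d j t (\<pi> t)) \<le> 4 * (\<Sum>j=1..m. weight n j * level_radius n j t)"
    using common_representatives[of S "{1..m}" "space T" d c "level_radius n" "4 ^ (2 ^ n)" "weight n",
        OF S(1) _ S(2) pm c(1) card less_imp_le[OF weight_pos]] by auto
  have "((4::nat) ^ (2 ^ n)) ^ card {1..m} = 2 ^ (2 * m * 2 ^ n)"
    using power_mult[of "2::nat" 2 "m * 2 ^ n"] by (simp add: power_mult[symmetric] mult_ac)
  then show ?thesis using \<pi> unfolding level_cost_def by auto
qed

section \<open>Exceptional probability per level and comparison of constants\<close>

text \<open>At most \<open>exp (3 * m * 2 ^ n)\<close> pairs stand against a tail
  \<open>exp (- 6 * m * 2 ^ n)\<close>, which leaves at most \<open>exp (- 3 * 2 ^ n)\<close>. One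
  third of this exponent yields \<delta> by the condition on n, the other two a summable power of
  1/2, of which one half cancels the factor 2 of the tail bound.\<close>

lemma prob_bad_increments_le:
  assumes Q: "finite Q" "Q \<subseteq> space T \<times> space T" "card Q \<le> 2 ^ (3 * m * 2 ^ n)"
    and \<delta>: "0 < \<delta>" "ln (exp 1 / \<delta>) \<le> 2 ^ n"
  shows "prob (bad_increments Q (6 * real m * 2 ^ n)) \<le> \<delta> * (1/2) ^ Suc n"
proof -
  let ?x = "(2 :: real) ^ n"
  have x: "?x \<le> real m * ?x" using m by simp
  have "real (card Q) \<le> 2 ^ (3 * m * 2 ^ n)" using Q(3) by (metis of_nat_le_iff of_nat_numeral of_nat_power)
  also have "\<dots> \<le> exp 1 ^ (3 * m * 2 ^ n)"
    using exp_ge_add_one_self[of 1] by (intro power_mono) auto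
  also have "\<dots> = exp (3 * real m * ?x)" by (simp add: exp_of_nat_mult[symmetric])
  finally have card: "real (card Q) \<le> exp (3 * real m * ?x)" .
  have "prob (bad_increments Q (6 * real m * ?x)) \<le> real (card Q) * (2 * exp (- (6 * real m * ?x)))"
    using Q by (intro bad_increments) auto
  also have "\<dots> \<le> exp (3 * real m * ?x) * (2 * exp (- (6 * real m * ?x)))"
    by (intro mult_right_mono card) auto
  also have "\<dots> = 2 * exp (- 3 * (real m * ?x))" by (simp add: exp_add[symmetric])
  also have "\<dots> \<le> 2 * exp (- ?x + - 2 * ?x)" using x by simp
  also have "\<dots> = 2 * (exp (- ?x) * exp (- 2 * ?x))" by (simp add: exp_add[symmetric])
  also have "\<dots> \<le> 2 * (\<delta> * (1/2) ^ (n + 2))"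
  proof (intro mult_left_mono mult_mono)
    have "exp (- ?x) \<le> exp (- (1 - ln \<delta>))" using \<delta> by (simp add: ln_div)
    also have "\<dots> \<le> exp (ln \<delta>)" by simp
    finally show "exp (- ?x) \<le> \<delta>" using \<delta> by simp
    have "(2::real) \<le> exp 1" using exp_ge_add_one_self[of 1] by simp
    then have "exp (- 1) \<le> (1/2 :: real)" by (simp add: exp_minus field_simps)
    have "exp (- 2 * ?x) = exp (- 1) ^ (2 * 2 ^ n)" by (simp add: exp_of_nat_mult[symmetric])
    also have "\<dots> \<le> (1/2) ^ (2 * 2 ^ n)" by (intro power_mono) (use \<open>exp (- 1) \<le> 1/2\<close> in auto)
    also have "\<dots> \<le> (1/2) ^ (n + 2)"
    proof (rule power_decreasing)
      have "Suc n \<le> 2 ^ n" by (rule Suc_leI[OF less_exp])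
      then show "n + 2 \<le> 2 * 2 ^ n" by simp
    qed auto
    finally show "exp (- 2 * ?x) \<le> (1/2) ^ (n + 2)" .
  qed (use \<delta> in auto)
  finally show ?thesis by simp
qed

text \<open>Being real-valued, it can be approximated along a dense set. As \<open>enn2real\<close>
  sends infinity to 0, it represents the right-hand side only where all integrals are
  finite.\<close>

definition path_bound :: "real \<Rightarrow> 't \<Rightarrow> real" where
  "path_bound \<delta> t = (\<Sum>j=1..m. enn2real (Phi T (d j) (\<mu> j) (\<alpha> j) t0 t)
     + d j t t0 * ln (exp 1 / \<delta>) powr (1 / \<alpha> j))"

lemma const_bound_ge:
  assumes j: "j \<in> {1..m}"
  shows "100 * ((100 * real m) powr (1 / \<alpha> j) / (1 - 2 powr (- 1 / \<alpha> j))) \<le> const_bound m \<alpha>"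
proof -
  have "(100 * real m) powr (1 / \<alpha> j) \<le> (\<Sum>j=1..m. (100 * real m) powr (1 / \<alpha> j))"
    using j by (intro member_le_sum) auto
  moreover have "1 / (1 - 2 powr (- 1 / \<alpha> j)) \<le> (\<Sum>j=1..m. 1 / (1 - 2 powr (- 1 / \<alpha> j)))"
    using j one_minus_two_powr_pos[OF \<alpha>] by (intro member_le_sum) (auto simp: less_imp_le)
  ultimately have "(100 * real m) powr (1 / \<alpha> j) * (1 / (1 - 2 powr (- 1 / \<alpha> j)))
      \<le> (\<Sum>j=1..m. (100 * real m) powr (1 / \<alpha> j)) * (\<Sum>j=1..m. 1 / (1 - 2 powr (- 1 / \<alpha> j)))"
    using one_minus_two_powr_pos[OF \<alpha>[OF j]] by (intro mult_mono sum_nonneg) auto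
  then show ?thesis unfolding const_bound_def by simp
qed

text \<open>The comparison is made for each j separately: 12 and 24 are at most 100 inside the
  powers and 8 is at most 100 outside. The first link carries no denominator, and introducing one
  only enlarges it, because \<open>1 - 2 powr (- 1 / \<alpha> j)\<close> is at most 1.\<close>

lemma chain_total_le:
  assumes t: "t \<in> space T" and u: "0 \<le> u" "u \<le> 12 * real m * ln (exp 1 / \<delta>)"
    and \<delta>: "0 < \<delta>" "\<delta> < 1"
  shows "(\<Sum>j=1..m. u powr (1 / \<alpha> j) * d j t t0) + 8 * majorant t \<le> const_bound m \<alpha> * path_bound \<delta> t"
proof -
  let ?L = "ln (exp 1 / \<delta>)" and ?C = "const_bound m \<alpha>"
  have "?L = 1 - ln \<delta>" "ln \<delta> < 0" using \<delta> by (simp_all add: ln_div)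
  then have L: "?L > 0" by linarith
  have "(\<Sum>j=1..m. u powr (1 / \<alpha> j) * d j t t0) + 8 * majorant t
      = (\<Sum>j=1..m. u powr (1 / \<alpha> j) * d j t t0 + 8 * ((24 * real m) powr (1 / \<alpha> j) /
          (1 - 2 powr (- 1 / \<alpha> j)) * enn2real (Phi T (d j) (\<mu> j) (\<alpha> j) t0 t)))"
    by (simp add: majorant_def sum.distrib sum_distrib_left)
  also have "\<dots> \<le> (\<Sum>j=1..m. ?C * (enn2real (Phi T (d j) (\<mu> j) (\<alpha> j) t0 t)
     + d j t t0 * ?L powr (1 / \<alpha> j)))"
  proof (rule sum_mono)
    fix j assume j: "j \<in> {1..m}"
    define p where "p = 1 / \<alpha> j"
    define b where "b = 1 - 2 powr (- 1 / \<alpha> j)"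
    define A where "A = (100 * real m) powr p"
    have p: "p > 0" using \<alpha>[OF j] by (simp add: p_def)
    have b: "0 < b" "b \<le> 1" using one_minus_two_powr_pos[OF \<alpha>[OF j]] by (auto simp: b_def)
    have C: "100 * (A / b) \<le> ?C" using const_bound_ge[OF j] by (simp add: A_def b_def p_def)
    have A: "0 \<le> A" "A \<le> A / b" using b by (auto simp: A_def pos_le_divide_eq mult_left_le)
    have mono: "(c * real m) powr p \<le> A" if "0 \<le> c" "c \<le> 100" for c
      unfolding A_def using that p by (intro powr_mono2 mult_right_mono) auto
    have "u powr p \<le> (12 * real m * ?L) powr p" using u p by (intro powr_mono2) auto
    also have "\<dots> = (12 * real m) powr p * ?L powr p" using L by (simp add: powr_mult)
    also have "\<dots> \<le> ?C * ?L powr p"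
      using mono[of 12] A C by (intro mult_right_mono) auto
    finally have 1: "u powr p * d j t t0 \<le> ?C * ?L powr p * d j t t0"
      using d_nonneg[OF j t t0] by (intro mult_right_mono)
    have "8 * ((24 * real m) powr p / b) \<le> 8 * (A / b)"
      using mono[of 24] b by (intro mult_left_mono divide_right_mono) auto
    also have "\<dots> \<le> ?C" using A C by linarith
    finally have "8 * ((24 * real m) powr p / b) * enn2real (Phi T (d j) (\<mu> j) (\<alpha> j) t0 t)
        \<le> ?C * enn2real (Phi T (d j) (\<mu> j) (\<alpha> j) t0 t)"
      by (intro mult_right_mono) auto
    with 1 show "u powr (1 / \<alpha> j) * d j t t0 + 8 * ((24 * real m) powr (1 / \<alpha> j) /
          (1 - 2 powr (- 1 / \<alpha> j)) * enn2real (Phi T (d j) (\<mu> j) (\<alpha> j) t0 t))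
        \<le> ?C * (enn2real (Phi T (d j) (\<mu> j) (\<alpha> j) t0 t) + d j t t0 * ?L powr (1 / \<alpha> j))"
      unfolding p_def b_def by (simp add: algebra_simps)
  qed
  also have "\<dots> = ?C * path_bound \<delta> t" by (simp add: path_bound_def sum_distrib_left)
  finally show ?thesis .
qed

section \<open>The chain on a finite set\<close>

text \<open>The weighted displacement stays below \<open>4 * majorant t\<close> while the weights
  tend to infinity. A finite set has only finitely many positive distances, so from some level on
  every displacement is zero.\<close>

lemma eventually_level_map_exact:
  assumes S: "finite S" "S \<subseteq> space T"
    and fin: "\<And>t j. t \<in> S \<Longrightarrow> j \<in> {1..m} \<Longrightarrow> Phi T (d j) (\<mu> j) (\<alpha> j) t0 t < \<infinity>"
    and \<pi>: "\<And>n. \<pi> n ` S \<subseteq> S"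
      "\<And>n t. t \<in> S \<Longrightarrow> (\<Sum>j=1..m. weight n j * d j t (\<pi> n t)) \<le> 4 * level_cost n t"
  shows "\<forall>\<^sub>F n in sequentially. \<forall>t\<in>S. \<forall>j\<in>{1..m}. d j t (\<pi> n t) = 0"
proof -
  have "\<forall>\<^sub>F n in sequentially. \<forall>t\<in>S. \<forall>s\<in>S. \<forall>j\<in>{1..m}.
      0 < d j t s \<longrightarrow> 4 * majorant t / d j t s < weight n j"
  proof (intro eventually_ball_finite ballI)
    fix t s j assume j: "j \<in> {1..m}"
    have "filterlim (\<lambda>n. (2 ^ n) powr (1 / \<alpha> j)) at_top sequentially"
    proof -
      have "1 < 2 powr (1 / \<alpha> j)" using powr_less_mono[of 0 "1 / \<alpha> j" 2] \<alpha>[OF j] by simp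
      then have "filterlim (\<lambda>n. (2 powr (1 / \<alpha> j)) ^ n) at_infinity sequentially"
        by (intro filterlim_realpow_sequentially_gt1) simp
      then have "filterlim (\<lambda>n. (2 powr (1 / \<alpha> j)) ^ n) at_top sequentially"
        by (rule filterlim_at_infinity_imp_filterlim_at_top) auto
      moreover have "(2 powr (1 / \<alpha> j)) ^ n = (2 ^ n) powr (1 / \<alpha> j)" for n
        by (simp add: powr_realpow[symmetric] powr_powr mult.commute)
      ultimately show ?thesis by simp
    qed
    then have "filterlim (\<lambda>n. (12 * real m) powr (1 / \<alpha> j) * (2 ^ n) powr (1 / \<alpha> j)) at_top sequentially"
      using m by (intro filterlim_tendsto_pos_mult_at_top[OF tendsto_const]) auto
    then have "filterlim (\<lambda>n. weight n j) at_top sequentially"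
      by (simp add: weight_def powr_mult)
    then show "\<forall>\<^sub>F n in sequentially. 0 < d j t s \<longrightarrow> 4 * majorant t / d j t s < weight n j"
      by (auto simp: filterlim_at_top_dense elim: eventually_mono)
  qed (use S in auto)
  then show ?thesis
  proof (rule eventually_mono, intro ballI)
    fix n t j
    assume n: "\<forall>t\<in>S. \<forall>s\<in>S. \<forall>j\<in>{1..m}. 0 < d j t s \<longrightarrow> 4 * majorant t / d j t s < weight n j"
      and t: "t \<in> S" and j: "j \<in> {1..m}"
    have sp: "t \<in> space T" "\<pi> n t \<in> S" "\<pi> n t \<in> space T" using t \<pi>(1)[of n] S by auto
    have "weight n j * d j t (\<pi> n t) \<le> (\<Sum>j=1..m. weight n j * d j t (\<pi> n t))"
      using j sp d_nonneg less_imp_le[OF weight_pos] by (intro member_le_sum) auto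
    also have "\<dots> \<le> 4 * level_cost n t" by (rule \<pi>(2)[OF t])
    also have "level_cost n t \<le> (\<Sum>k<Suc n. level_cost k t)"
      using level_cost_nonneg[OF sp(1)] by (intro member_le_sum) auto
    also have "\<dots> \<le> majorant t" using sum_level_cost_le_majorant[OF sp(1) fin[OF t]] by blast
    finally have le: "weight n j * d j t (\<pi> n t) \<le> 4 * majorant t" by simp
    show "d j t (\<pi> n t) = 0"
    proof (rule ccontr)
      assume "d j t (\<pi> n t) \<noteq> 0"
      then have "0 < d j t (\<pi> n t)" using d_nonneg[OF j sp(1,3)] by simp
      moreover from this have "4 * majorant t / d j t (\<pi> n t) < weight n j" using n t sp j by blast
      ultimately show False using le by (simp add: field_simps)
    qed
  qed
qed

text \<open>Points at \<rho>-distance zero lie in every neighbourhood of each other, so a continuous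
  path cannot separate them. This lets a chain end at a representative that differs from t.\<close>

lemma path_eq_if_dist_zero:
  assumes "\<omega> \<in> W" "s \<in> space T" "t \<in> space T" "\<And>j. j \<in> {1..m} \<Longrightarrow> d j s t = 0"
  shows "Z \<omega> s = Z \<omega> t"
proof (rule ccontr)
  assume "Z \<omega> s \<noteq> Z \<omega> t"
  then have "0 < norm (Z \<omega> t - Z \<omega> s)" by simp
  moreover have "sum_metric m d s t = 0" using assms(4) by (simp add: sum_metric_def)
  ultimately show False
    using path[OF assms(1)] assms(2,3) unfolding continuous_wrt_def by (metis less_irrefl)
qed

lemma finite_set_bound:
  assumes S: "finite S" "S \<subseteq> space T"
    and fin: "\<And>t j. t \<in> S \<Longrightarrow> j \<in> {1..m} \<Longrightarrow> Phi T (d j) (\<mu> j) (\<alpha> j) t0 t < \<infinity>"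
    and \<delta>: "0 < \<delta>" "\<delta> < 1"
  shows "\<exists>E\<in>events. E \<subseteq> W \<and> 1 - \<delta> \<le> prob E \<and>
    (\<forall>\<omega>\<in>E. \<forall>t\<in>S. norm (Z \<omega> t) \<le> const_bound m \<alpha> * path_bound \<delta> t)"
proof -
  define L where "L = ln (exp 1 / \<delta>)"
  have "L = 1 - ln \<delta>" "ln \<delta> < 0" using \<delta> by (simp_all add: L_def ln_div)
  then have L: "L > 1" by linarith
  \<comment> \<open>Both inequalities matter: \<open>L \<le> 2 ^ Suc n0\<close> feeds the union
    bound at the first link, and \<open>2 ^ n0 < L\<close> bounds the tail parameter of that link by
    \<open>12 * m * L\<close>. Since \<open>L > 1\<close>, level 0 is too low and a preceding level
    exists.\<close>
  obtain n0 where n0: "L \<le> 2 ^ Suc n0" "2 ^ n0 < L"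
  proof -
    obtain k where "L < 2 ^ k" using real_arch_pow[of 2 L] by auto
    moreover define n where "n = (LEAST k. L \<le> 2 ^ k)"
    ultimately have n: "L \<le> 2 ^ n"
      using LeastI[of "\<lambda>k. L \<le> 2 ^ k" k] by (simp only: less_imp_le)
    then obtain n' where n': "n = Suc n'" using L by (cases n) auto
    then have "\<not> L \<le> 2 ^ n'" using not_less_Least[of n' "\<lambda>k. L \<le> 2 ^ k"] by (simp add: n_def)
    with n n' show ?thesis by (intro that[of n']) (simp_all add: not_le)
  qed
  obtain \<pi> where "\<forall>n. \<pi> n ` S \<subseteq> S \<and> card (\<pi> n ` S) \<le> 2 ^ (2 * m * 2 ^ n) \<and>
      (\<forall>t\<in>S. (\<Sum>j=1..m. weight n j * d j t (\<pi> n t)) \<le> 4 * level_cost n t)"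
    using choice[OF allI[OF level_map[OF S]]] ..
  then have \<pi>: "\<pi> n ` S \<subseteq> S" "card (\<pi> n ` S) \<le> 2 ^ (2 * m * 2 ^ n)"
      "t \<in> S \<Longrightarrow> (\<Sum>j=1..m. weight n j * d j t (\<pi> n t)) \<le> 4 * level_cost n t" for n t
    by simp_all
  have \<pi>S: "\<pi> n t \<in> S" "\<pi> n t \<in> space T" if "t \<in> S" for n t using \<pi>(1)[of n] that S by auto
  obtain N1 where N1: "\<And>n. n \<ge> N1 \<Longrightarrow> \<forall>t\<in>S. \<forall>j\<in>{1..m}. d j t (\<pi> n t) = 0"
    using eventually_level_map_exact[OF S fin \<pi>(1,3)] unfolding eventually_sequentially by blast
  define N where "N = max N1 (Suc n0)"
  \<comment> \<open>Levels up to \<open>n0\<close> collapse to the anchor, so the first link runs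
    from \<open>t0\<close> to level \<open>Suc n0\<close>.\<close>
  define q where "q n t = (if n \<le> n0 then t0 else \<pi> n t)" for n t
  define Q where "Q n = (\<lambda>t. (q n t, q (Suc n) t)) ` S" for n
  define u where "u n = 6 * real m * 2 ^ Suc n" for n
  define B where "B = (\<Union>n\<in>{n0..<N}. bad_increments (Q n) (u n))"
  have q: "q n t \<in> space T" if "t \<in> S" for n t using \<pi>S[OF that] t0 by (simp add: q_def)
  have Q: "finite (Q n)" "Q n \<subseteq> space T \<times> space T" for n using S q by (auto simp: Q_def)
  have cardq: "card (q n ` S) \<le> 2 ^ (2 * m * 2 ^ n)" for n
  proof (cases "n \<le> n0")
    case True
    then have "q n ` S \<subseteq> {t0}" by (auto simp: q_def)
    then have "card (q n ` S) \<le> 1" using card_mono[of "{t0}"] by simp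
    then show ?thesis by (meson one_le_numeral one_le_power order_trans)
  next
    case False
    then show ?thesis using \<pi>(2)[of n] by (simp add: q_def[abs_def])
  qed
  have "card (Q n) \<le> 2 ^ (3 * m * 2 ^ Suc n)" for n
  proof -
    have "card (Q n) \<le> card (q n ` S \<times> q (Suc n) ` S)"
      using S by (intro card_mono) (auto simp: Q_def)
    \<comment> \<open>The exponents of the two end levels add up to
      \<open>3 * m * 2 ^ Suc n\<close>, the form required by \<open>prob_bad_increments_le\<close>
      at level \<open>Suc n\<close>.\<close>
    also have "\<dots> \<le> 2 ^ (2 * m * 2 ^ n) * 2 ^ (2 * m * 2 ^ Suc n)"
      unfolding card_cartesian_product by (intro mult_mono cardq) auto
    also have "\<dots> = 2 ^ (3 * m * 2 ^ Suc n)" by (simp add: power_add[symmetric])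
    finally show ?thesis .
  qed
  moreover have "L \<le> 2 ^ Suc n" if "n0 \<le> n" for n
    using n0(1) power_increasing[of "Suc n0" "Suc n" "2 :: real"] that by linarith
  ultimately have probQ: "prob (bad_increments (Q n) (u n)) \<le> \<delta> * (1/2) ^ Suc (Suc n)" if "n0 \<le> n" for n
    unfolding u_def using that Q \<delta> by (intro prob_bad_increments_le) (auto simp: L_def[symmetric] simp del: power_Suc)
  have evQ: "bad_increments (Q n) (u n) \<in> events" for n
    using Q by (intro bad_increments) (auto simp: u_def)
  have B: "B \<in> events" unfolding B_def using evQ by auto
  have "prob B \<le> (\<Sum>n\<in>{n0..<N}. prob (bad_increments (Q n) (u n)))"
    unfolding B_def using evQ by (intro finite_measure_subadditive_finite) auto
  also have "\<dots> \<le> (\<Sum>n\<in>{n0..<N}. \<delta> * (1/2) ^ Suc (Suc n))" by (intro sum_mono probQ) auto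
  also have "\<dots> \<le> (\<Sum>n<N. \<delta> * (1/2) ^ Suc (Suc n))" using \<delta> by (intro sum_mono2) auto
  also have "\<dots> = \<delta> * (1 - (1/2) ^ N) / 2"
    by (induction N) (auto simp: field_simps)
  also have "\<dots> \<le> \<delta>" using \<delta> by (simp add: field_simps)
  finally have probB: "prob B \<le> \<delta>" .
  have "prob (W - B) = prob W - prob (W \<inter> B)" using W B by (intro finite_measure_Diff')
  moreover have "prob (W \<inter> B) \<le> prob B" using B by (intro finite_measure_mono) auto
  ultimately have probE: "1 - \<delta> \<le> prob (W - B)" using probB W by simp
  have "norm (Z \<omega> t) \<le> const_bound m \<alpha> * path_bound \<delta> t" if \<omega>: "\<omega> \<in> W - B" and t: "t \<in> S" for \<omega> t
  proof -
    have tT: "t \<in> space T" using t S by auto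
    have \<omega>P: "\<omega> \<in> space P" using \<omega> sets.sets_into_space[OF W(1)] by auto
    define c where "c n v = (\<Sum>j=1..m. u n powr (1 / \<alpha> j) * v j)" for n and v :: "nat \<Rightarrow> real"
    have c_mono: "c n v \<le> c n v'" if "\<And>j. j \<in> {1..m} \<Longrightarrow> v j \<le> v' j" for n v v'
      unfolding c_def using that by (intro sum_mono mult_left_mono) auto
    have c_add: "c n (\<lambda>j. v j + v' j) = c n v + c n v'" for n v v'
      by (simp add: c_def sum.distrib algebra_simps)
    \<comment> \<open>Each link is split at t, because the level costs control only the distances
      from t to its own representatives.\<close>
    have incr: "norm (Z \<omega> (q (Suc n) t) - Z \<omega> (q n t))
        \<le> c n (\<lambda>j. d j t (q (Suc n) t)) + c n (\<lambda>j. d j t (q n t))" if "n0 \<le> n" "n < N" for n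
    proof -
      have "\<omega> \<notin> bad_increments (Q n) (u n)" using \<omega> that by (auto simp: B_def)
      moreover have "(q n t, q (Suc n) t) \<in> Q n" using t by (auto simp: Q_def)
      ultimately have "norm (Z \<omega> (q (Suc n) t) - Z \<omega> (q n t))
          \<le> c n (\<lambda>j. d j (q (Suc n) t) (q n t))"
        using \<omega>P unfolding bad_increments_def c_def by force
      also have "\<dots> \<le> c n (\<lambda>j. d j t (q (Suc n) t) + d j t (q n t))"
        using q[OF t] tT by (intro c_mono d_triangle) auto
      finally show ?thesis by (simp add: c_add)
    qed
    \<comment> \<open>The tail parameter of a link is at most the one behind the weights at either
      end level.\<close>
    have c_le: "c n (\<lambda>j. d j t (\<pi> k t)) \<le> 4 * level_cost k t" if "n = k \<or> Suc n = k" for n k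
    proof -
      have "c n (\<lambda>j. d j t (\<pi> k t)) \<le> (\<Sum>j=1..m. weight k j * d j t (\<pi> k t))"
        unfolding c_def
      proof (intro sum_mono mult_right_mono)
        fix j assume j: "j \<in> {1..m}"
        show "u n powr (1 / \<alpha> j) \<le> weight k j"
          unfolding u_def weight_def using that \<alpha>[OF j] m by (intro powr_mono2) auto
        show "0 \<le> d j t (\<pi> k t)" using d_nonneg[OF j tT] \<pi>S[OF t] by auto
      qed
      also have "\<dots> \<le> 4 * level_cost k t" by (rule \<pi>(3)[OF t])
      finally show ?thesis .
    qed
    \<comment> \<open>An inner level is an endpoint of two links and is charged 4 for each; the
      level reached last has been charged only once.\<close>
    have chain: "norm (Z \<omega> (\<pi> n t)) \<le> c n0 (\<lambda>j. d j t t0) + 8 * (\<Sum>k<n. level_cost k t) + 4 * level_cost n t"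
      if "Suc n0 \<le> n" "n \<le> N" for n
      using that
    proof (induction n rule: dec_induct)
      case base
      have "norm (Z \<omega> (\<pi> (Suc n0) t)) \<le> c n0 (\<lambda>j. d j t t0) + 4 * level_cost (Suc n0) t"
        using incr[of n0] c_le[of n0 "Suc n0"] base path[of \<omega>] \<omega> by (simp add: q_def)
      moreover have "0 \<le> (\<Sum>k<Suc n0. level_cost k t)" using level_cost_nonneg[OF tT] by (intro sum_nonneg)
      ultimately show ?case by linarith
    next
      case (step n)
      have "norm (Z \<omega> (\<pi> (Suc n) t)) \<le> norm (Z \<omega> (\<pi> n t)) + norm (Z \<omega> (\<pi> (Suc n) t) - Z \<omega> (\<pi> n t))"
        by (rule norm_triangle_sub)
      also have "norm (Z \<omega> (\<pi> (Suc n) t) - Z \<omega> (\<pi> n t)) \<le> 4 * level_cost (Suc n) t + 4 * level_cost n t"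
        using incr[of n] c_le[of n "Suc n"] c_le[of n n] step.hyps step.prems by (simp add: q_def)
      finally show ?case using step by simp
    qed
    \<comment> \<open>At level \<open>N\<close> the representative is at distance zero from t, so
      finitely many links suffice.\<close>
    have "norm (Z \<omega> t) = norm (Z \<omega> (\<pi> N t))"
      using path_eq_if_dist_zero[of \<omega> t "\<pi> N t"] N1[of N] \<omega> tT \<pi>S[OF t] t by (auto simp: N_def)
    also have "\<dots> \<le> c n0 (\<lambda>j. d j t t0) + 8 * (\<Sum>k<N. level_cost k t) + 4 * level_cost N t"
      by (rule chain) (auto simp: N_def)
    also have "\<dots> \<le> c n0 (\<lambda>j. d j t t0) + 8 * (\<Sum>k<Suc N. level_cost k t)"
      using level_cost_nonneg[OF tT, of N] by simp
    also have "\<dots> \<le> c n0 (\<lambda>j. d j t t0) + 8 * majorant t"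
      using sum_level_cost_le_majorant[OF tT fin[OF t], of "Suc N"] by simp
    also have "\<dots> \<le> const_bound m \<alpha> * path_bound \<delta> t"
      unfolding c_def
    proof (rule chain_total_le[OF tT _ _ \<delta>])
      have "real m * 2 ^ n0 \<le> real m * L" using n0(2) by (intro mult_left_mono) auto
      then show "u n0 \<le> 12 * real m * ln (exp 1 / \<delta>)" by (simp add: u_def L_def)
    qed (simp add: u_def)
    finally show ?thesis .
  qed
  then show ?thesis using W B probE by (intro bexI[of _ "W - B"]) auto
qed

section \<open>Passage from finite sets to the whole index space\<close>

lemma ennreal_path_bound:
  assumes "t \<in> space T" and "\<And>j. j \<in> {1..m} \<Longrightarrow> Phi T (d j) (\<mu> j) (\<alpha> j) t0 t < \<infinity>"
  shows "(\<Sum>j=1..m. Phi T (d j) (\<mu> j) (\<alpha> j) t0 t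
    + ennreal (d j t t0 * ln (exp 1 / \<delta>) powr (1 / \<alpha> j))) = ennreal (path_bound \<delta> t)"
proof -
  have nn: "0 \<le> d j t t0 * ln (exp 1 / \<delta>) powr (1 / \<alpha> j)" if "j \<in> {1..m}" for j
    using d_nonneg[OF that assms(1) t0] by simp
  have "(\<Sum>j=1..m. Phi T (d j) (\<mu> j) (\<alpha> j) t0 t
      + ennreal (d j t t0 * ln (exp 1 / \<delta>) powr (1 / \<alpha> j)))
    = (\<Sum>j=1..m. ennreal (enn2real (Phi T (d j) (\<mu> j) (\<alpha> j) t0 t)
      + d j t t0 * ln (exp 1 / \<delta>) powr (1 / \<alpha> j)))"
    using assms(2) nn by (intro sum.cong) (auto simp: ennreal_plus)
  also have "\<dots> = ennreal (path_bound \<delta> t)"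
    unfolding path_bound_def using nn by (intro sum_ennreal add_nonneg_nonneg) auto
  finally show ?thesis .
qed

lemma pseudo_metric_sum: "pseudo_metric_on (space T) (sum_metric m d)"
  unfolding pseudo_metric_on_def sum_metric_def
proof (intro conjI ballI)
  fix x y z assume xyz: "x \<in> space T" "y \<in> space T" "z \<in> space T"
  show "(\<Sum>j=1..m. d j x z) \<le> (\<Sum>j=1..m. d j x y) + (\<Sum>j=1..m. d j y z)"
    unfolding sum.distrib[symmetric]
    using pm xyz by (intro sum_mono) (auto simp: pseudo_metric_on_def)
next
  fix x y assume xy: "x \<in> space T" "y \<in> space T"
  show "0 \<le> (\<Sum>j=1..m. d j x y)" using d_nonneg xy by (intro sum_nonneg) auto
  show "(\<Sum>j=1..m. d j x y) = (\<Sum>j=1..m. d j y x)"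
    using pm xy by (intro sum.cong) (auto simp: pseudo_metric_on_def)
next
  fix x assume "x \<in> space T"
  then show "(\<Sum>j=1..m. d j x x) = 0" using pm by (intro sum.neutral) (auto simp: pseudo_metric_on_def)
qed

text \<open>The events of \<open>finite_set_bound\<close> need not be nested. Each lies in
  \<open>G k\<close>, where the bound holds on \<open>F k\<close>; these decrease, so their
  intersection keeps probability at least \<open>1 - \<delta>\<close>. There the bound holds on
  \<open>D\<close> and passes to \<open>S\<close> by continuity of the path and density of
  \<open>D\<close> for both \<rho> and \<open>path_bound\<close>.\<close>

lemma pathwise_bound:
  assumes sep: "separable_on (space T) (sum_metric m d)" and \<delta>: "0 < \<delta>" "\<delta> < 1"
  shows "\<exists>E\<in>events. 1 - \<delta> \<le> prob E \<and> (\<forall>\<omega>\<in>E. \<forall>t\<in>space T.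
    ennreal (norm (Z \<omega> t)) \<le> ennreal (const_bound m \<alpha>) *
      (\<Sum>j=1..m. Phi T (d j) (\<mu> j) (\<alpha> j) t0 t + ennreal (d j t t0 * ln (exp 1 / \<delta>) powr (1 / \<alpha> j))))"
proof -
  let ?C = "const_bound m \<alpha>" and ?\<rho> = "sum_metric m d"
  define S where "S = {t \<in> space T. \<forall>j\<in>{1..m}. Phi T (d j) (\<mu> j) (\<alpha> j) t0 t < \<infinity>}"
  have C: "0 < ?C" using const_bound_pos[OF m \<alpha>] .
  obtain D where D: "D \<subseteq> S" "countable D"
    "\<And>t e. t \<in> S \<Longrightarrow> 0 < e \<Longrightarrow> \<exists>s\<in>D. ?\<rho> t s < e \<and> \<bar>path_bound \<delta> t - path_bound \<delta> s\<bar> < e"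
    using separable_on_graph[OF sep pseudo_metric_sum, of S "path_bound \<delta>"] by (auto simp: S_def)
  define F where "F k = to_nat_on D -` {..<k} \<inter> D" for k
  have F: "finite (F k)" "F k \<subseteq> S" "F k \<subseteq> space T" for k
    using D unfolding F_def S_def by (auto intro!: finite_vimage_IntI)
  have "incseq F" by (auto simp: F_def incseq_def)
  define G where "G k = W - (\<Union>t\<in>F k. {\<omega> \<in> space P. ?C * path_bound \<delta> t < norm (Z \<omega> t)})" for k
  have G: "G k \<in> events" for k
  proof -
    have "{\<omega> \<in> space P. ?C * path_bound \<delta> t < norm (Z \<omega> t)} \<in> events" if "t \<in> F k" for t
    proof -
      have [measurable]: "(\<lambda>\<omega>. Z \<omega> t) \<in> borel_measurable P" using that F(3) by (intro Z) blast
      show ?thesis by measurable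
    qed
    then show ?thesis unfolding G_def using W F by (intro sets.Diff sets.finite_UN) auto
  qed
  have "1 - \<delta> \<le> prob (G k)" for k
  proof -
    have finite_Phi: "Phi T (d j) (\<mu> j) (\<alpha> j) t0 t < \<infinity>" if "t \<in> F k" "j \<in> {1..m}" for t j
      using that F(2)[of k] unfolding S_def by blast
    have "\<exists>E\<in>events. E \<subseteq> W \<and> 1 - \<delta> \<le> prob E \<and>
        (\<forall>\<omega>\<in>E. \<forall>t\<in>F k. norm (Z \<omega> t) \<le> ?C * path_bound \<delta> t)"
      by (rule finite_set_bound[OF F(1,3) _ \<delta>]) (rule finite_Phi)
    then obtain E where E: "E \<in> events" "E \<subseteq> W" "1 - \<delta> \<le> prob E"
      "\<forall>\<omega>\<in>E. \<forall>t\<in>F k. norm (Z \<omega> t) \<le> ?C * path_bound \<delta> t"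
      by (elim bexE conjE)
    then have "E \<subseteq> G k" unfolding G_def by (fastforce simp: not_less[symmetric])
    then have "prob E \<le> prob (G k)" by (rule finite_measure_mono[OF _ G])
    with E(3) show ?thesis by linarith
  qed
  moreover have "(\<lambda>k. prob (G k)) \<longlonglongrightarrow> prob (\<Inter>k. G k)"
  proof (rule finite_Lim_measure_decseq)
    show "decseq G" using \<open>incseq F\<close> unfolding G_def incseq_def decseq_def by blast
  qed (use G in auto)
  ultimately have probE: "1 - \<delta> \<le> prob (\<Inter>k. G k)" using Lim_bounded2[of "\<lambda>k. prob (G k)" _ 0] by blast
  have "ennreal (norm (Z \<omega> t)) \<le> ennreal ?C *
      (\<Sum>j=1..m. Phi T (d j) (\<mu> j) (\<alpha> j) t0 t + ennreal (d j t t0 * ln (exp 1 / \<delta>) powr (1 / \<alpha> j)))"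
    if \<omega>: "\<omega> \<in> (\<Inter>k. G k)" and t: "t \<in> space T" for \<omega> t
  proof (cases "t \<in> S")
    case False
    \<comment> \<open>Outside \<open>S\<close> the right-hand side is infinite, since the constant
      is positive.\<close>
    then obtain j where j: "j \<in> {1..m}" "Phi T (d j) (\<mu> j) (\<alpha> j) t0 t = \<top>"
      using t by (auto simp: S_def not_less top_unique)
    then have eq: "(\<Sum>j=1..m. Phi T (d j) (\<mu> j) (\<alpha> j) t0 t
        + ennreal (d j t t0 * ln (exp 1 / \<delta>) powr (1 / \<alpha> j))) = \<top>"
      by auto
    show ?thesis unfolding eq using C by (simp add: ennreal_mult_top)
  next
    case True
    have "\<omega> \<in> W" "\<omega> \<in> space P" using \<omega> sets.sets_into_space[OF W(1)] by (auto simp: G_def)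
    have bound: "norm (Z \<omega> s) \<le> ?C * path_bound \<delta> s" if "s \<in> D" for s
    proof -
      have "s \<in> F (Suc (to_nat_on D s))" using that by (simp add: F_def)
      moreover have "\<omega> \<in> G (Suc (to_nat_on D s))" using \<omega> by blast
      ultimately show ?thesis using \<open>\<omega> \<in> space P\<close> unfolding G_def by force
    qed
    have "norm (Z \<omega> t) \<le> ?C * path_bound \<delta> t"
    proof (rule field_le_epsilon)
      fix e :: real assume e: "0 < e"
      have "continuous_wrt (space T) ?\<rho> (Z \<omega>)" using path[OF \<open>\<omega> \<in> W\<close>] by blast
      then obtain \<eta> where \<eta>: "\<eta> > 0" "\<And>y. y \<in> space T \<Longrightarrow> ?\<rho> t y < \<eta> \<Longrightarrow> norm (Z \<omega> y - Z \<omega> t) < e / 2"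
        unfolding continuous_wrt_def using t half_gt_zero[OF e] by blast
      \<comment> \<open>Half of \<open>e\<close> is spent on the path and half on the constant times
        the change of \<open>path_bound\<close>.\<close>
      have "0 < min \<eta> (e / (2 * ?C))" using \<eta> e C by simp
      then obtain s where s: "s \<in> D" "?\<rho> t s < min \<eta> (e / (2 * ?C))"
        "\<bar>path_bound \<delta> t - path_bound \<delta> s\<bar> < min \<eta> (e / (2 * ?C))"
        using D(3)[OF True] by blast
      then have "s \<in> space T" using D(1) by (auto simp: S_def)
      then have "norm (Z \<omega> s - Z \<omega> t) < e / 2" using \<eta>(2) s(2) by simp
      moreover have "?C * path_bound \<delta> s \<le> ?C * (path_bound \<delta> t + e / (2 * ?C))"
        using s(3) C by (intro mult_left_mono) auto
      moreover have "?C * (path_bound \<delta> t + e / (2 * ?C)) = ?C * path_bound \<delta> t + e / 2"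
        using C by (simp add: field_simps)
      moreover have "norm (Z \<omega> t) \<le> norm (Z \<omega> s) + norm (Z \<omega> s - Z \<omega> t)"
        by (metis norm_minus_commute norm_triangle_sub)
      ultimately show "norm (Z \<omega> t) \<le> ?C * path_bound \<delta> t + e" using bound[OF s(1)] by linarith
    qed
    then have "ennreal (norm (Z \<omega> t)) \<le> ennreal ?C * ennreal (path_bound \<delta> t)"
      using C by (subst ennreal_mult'[symmetric]) (auto intro: ennreal_leI)
    then show ?thesis
      by (subst ennreal_path_bound) (use True in \<open>auto simp: S_def\<close>)
  qed
  then show ?thesis using G probE by (intro bexI[of _ "\<Inter>k. G k"]) auto
qed

end

theorem theorem3p1:
  fixes m :: nat and \<alpha> :: "nat \<Rightarrow> real"
  assumes "m \<ge> 1" and "\<And>j. j \<in> {1..m} \<Longrightarrow> \<alpha> j > 0"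
  shows "\<exists>C. 0 < C \<and> C \<le> const_bound m \<alpha> \<and>
    (\<forall>(P :: 'w measure) (T :: 't measure) (d :: nat \<Rightarrow> 't \<Rightarrow> 't \<Rightarrow> real)
      (Z :: 'w \<Rightarrow> 't \<Rightarrow> 'b::{banach, second_countable_topology}) (t0 :: 't)
      (\<mu> :: nat \<Rightarrow> 't measure).
      prob_space P \<longrightarrow>
      index_space m T d \<longrightarrow>
      (\<lambda>(\<omega>, t). Z \<omega> t) \<in> borel_measurable (P \<Otimes>\<^sub>M T) \<longrightarrow>
      anchored_continuous P T (sum_metric m d) t0 Z \<longrightarrow>
      mixed_tail m \<alpha> P T d Z \<longrightarrow>
      (\<forall>j\<in>{1..m}. prob_space (\<mu> j) \<and> sets (\<mu> j) = sets T) \<longrightarrow>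
      (\<forall>\<delta>. 0 < \<delta> \<and> \<delta> < 1 \<longrightarrow>
        (\<exists>E\<in>sets P. measure P E \<ge> 1 - \<delta> \<and>
          (\<forall>\<omega>\<in>E. \<forall>t\<in>space T.
            ennreal (norm (Z \<omega> t)) \<le>
              ennreal C * (\<Sum>j=1..m. Phi T (d j) (\<mu> j) (\<alpha> j) t0 t
                + ennreal (d j t t0 * ln (exp 1 / \<delta>) powr (1 / \<alpha> j)))))))"
proof (intro exI[of _ "const_bound m \<alpha>"] conjI allI impI)
  \<comment> \<open>The witness is the closed form itself, so the upper bound on the constant holds
    by reflexivity.\<close>
  show "0 < const_bound m \<alpha>" using const_bound_pos[of m \<alpha>] assms by blast
next
  fix P :: "'w measure" and T :: "'t measure" and d :: "nat \<Rightarrow> 't \<Rightarrow> 't \<Rightarrow> real"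
    and Z :: "'w \<Rightarrow> 't \<Rightarrow> 'b" and t0 :: 't and \<mu> :: "nat \<Rightarrow> 't measure" and \<delta> :: real
  assume P: "prob_space P" and ind: "index_space m T d"
    and Z: "(\<lambda>(\<omega>, t). Z \<omega> t) \<in> borel_measurable (P \<Otimes>\<^sub>M T)"
    and anch: "anchored_continuous P T (sum_metric m d) t0 Z"
    and tail: "mixed_tail m \<alpha> P T d Z"
    and \<mu>: "\<forall>j\<in>{1..m}. prob_space (\<mu> j) \<and> sets (\<mu> j) = sets T"
    and \<delta>: "0 < \<delta> \<and> \<delta> < 1"
  obtain W where W: "t0 \<in> space T" "W \<in> sets P" "measure P W = 1"
    "\<forall>\<omega>\<in>W. Z \<omega> t0 = 0 \<and> continuous_wrt (space T) (sum_metric m d) (Z \<omega>)"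
    using anch unfolding anchored_continuous_def by blast
  have "chaining P m \<alpha> T d Z t0 \<mu> W"
  proof (intro chaining.intro chaining_axioms.intro P)
    fix j assume "j \<in> {1..m}"
    then show "majorizing_measure (\<mu> j) T (d j) t0"
      using ind \<mu> W(1) unfolding index_space_def
      by (intro majorizing_measure.intro majorizing_measure_axioms.intro) auto
  next
    fix t assume "t \<in> space T"
    \<comment> \<open>Sections of a jointly measurable map are measurable, which gives the
      measurability of each \<open>Z_t\<close>.\<close>
    from measurable_compose[OF measurable_Pair2'[OF this] Z]
    show "(\<lambda>\<omega>. Z \<omega> t) \<in> borel_measurable P" by simp
  qed (use assms tail W in auto)
  moreover have "separable_on (space T) (sum_metric m d)" using ind unfolding index_space_def by blast
  ultimately show "\<exists>E\<in>sets P. measure P E \<ge> 1 - \<delta> \<and>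
          (\<forall>\<omega>\<in>E. \<forall>t\<in>space T.
            ennreal (norm (Z \<omega> t)) \<le>
              ennreal (const_bound m \<alpha>) * (\<Sum>j=1..m. Phi T (d j) (\<mu> j) (\<alpha> j) t0 t
                + ennreal (d j t t0 * ln (exp 1 / \<delta>) powr (1 / \<alpha> j))))"
    using chaining.pathwise_bound[of P m \<alpha> T d Z t0 \<mu> W \<delta>] \<delta> by simp
qed simp

end
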